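(* For $z\in\mathbb{C}$ with $|z|<1$, $$K^3(z)=\frac{\pi^3}{8}F^3\left(\tfrac12,\tfrac12;1;z^2\right)=\frac{\pi^3}{8}\sum_{n=0}^\infty v_n z^{2n},$$ where $v_0=1$, $v_1=3/4$, $v_2=39/64$ and $$v_{n+1}=\frac{2n(n+1)(6n(n+1)+7)+3}{4(n+1)^4}v_n-\frac{48n^4+32n^2+1}{16(n+1)^4}v_{n-1}+\frac{(1-2n)^4}{16(n+1)^4}v_{n-2},\qquad n\ge 2.$$
   Context: $K(z)=\int_0^{\pi/2}\frac{d\theta}{\sqrt{1-z^2\sin^2\theta}}$, $|z|<1$ (principal square root), is the complete elliptic integral of the first kind, and $K^3(z)=(K(z))^3$. $F(a,b;c;z)=\sum_{k=0}^\infty \frac{(a)_k(b)_k}{(c)_k\,k!}z^k$, $|z|<1$, is the Gaussian hypergeometric function, with $(x)_k=x(x+1)\cdots(x+k-1)$, $(x)_0=1$; $F^3$ denotes its cube. *)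

theory Defs
  imports "HOL-Analysis.Analysis"
begin

(* csqrt is the principal branch; only meaningful for norm z < 1, where
   the integrand is continuous. *)
definition elliptic_K :: "complex \<Rightarrow> complex" where
  "elliptic_K z =
     integral {0..pi / 2} (\<lambda>\<theta>. 1 / csqrt (1 - z\<^sup>2 * (complex_of_real (sin \<theta>))\<^sup>2))"

(* Only meaningful for norm z < 1 and c not a nonpositive integer. *)
definition hypergeo_F :: "complex \<Rightarrow> complex \<Rightarrow> complex \<Rightarrow> complex \<Rightarrow> complex" where
  "hypergeo_F a b c z =
     (\<Sum>k. pochhammer a k * pochhammer b k / (pochhammer c k * fact k) * z ^ k)"

end

theory Submission
  imports Defs
begin

text \<open>
  Expanding \<open>1 / csqrt (1 - z\<^sup>2 sin\<^sup>2 \<theta>)\<close> by the binomial theorem and integrating term by term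
  with Wallis' formula gives \<open>K z = \<pi>/2 \<cdot> F (z\<^sup>2)\<close>, where \<open>F\<close> is the power series with
  coefficients \<open>((1/2)\<^sub>k / k!)\<^sup>2\<close>, that is, \<open>F(1/2, 1/2; 1; x)\<close>
  (\<open>elliptic_K_eq_hypergeo_F\<close>). Cubing gives the first equation. Since \<open>F\<close> converges in the
  unit disc, so does the Cauchy product \<open>F\<^sup>3\<close>, and it remains to identify its coefficients.

  Let \<open>\<theta> = x d/dx\<close>. The quotient of consecutive coefficients of \<open>F\<close> is rational in the index,
  which means that \<open>F\<close> solves the second order equation
  \<open>4 (1 - x) \<theta>\<^sup>2F = x (4 \<theta>F + F)\<close> (\<open>elliptic_fps_ode\<close>). Over the rational functions
  the four cubic monomials in \<open>F\<close> and \<open>\<theta>F\<close> span a space that is closed under \<open>\<theta>\<close>,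
  so \<open>F\<^sup>3\<close> solves a linear equation of order four, the symmetric cube of the equation of \<open>F\<close>
  (\<open>elliptic_fps_cube_ode\<close>). The operator \<open>\<theta>\<close> multiplies the \<open>n\<close>th coefficient by \<open>n\<close>, and \<open>x\<close>
  shifts coefficients. The symmetric cube has degree three in \<open>x\<close>, so reading off its
  coefficients yields a recurrence with four terms, which is the stated one
  (\<open>elliptic_fps_cube_recurrence\<close>). Together with the first three coefficients it determines
  the sequence.
\<close>

unbundle fps_syntax
unbundle no vec_syntax

section \<open>The Wallis ratios\<close>

text \<open>
  These are the numbers \<open>(2k - 1)!! / (2k)!!\<close>. They occur both as the coefficients of
  \<open>(1 - w) powr (-1/2)\<close> and as the mean values of \<open>sin\<^bsup>2k\<^esup>\<close>, which is why their
  squares are the coefficients of the elliptic integral.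
\<close>

definition wallis :: "nat \<Rightarrow> 'a::field_char_0" where
  "wallis k = pochhammer (1/2) k / fact k"

lemma wallis_0 [simp]: "wallis 0 = 1"
  by (simp add: wallis_def)

lemma wallis_Suc:
  "wallis (Suc k) = of_nat (2 * k + 1) / of_nat (2 * k + 2) * (wallis k :: 'a::field_char_0)"
proof -
  have "(1 + of_nat k :: 'a) \<noteq> 0"
    by (metis of_nat_Suc of_nat_neq_0)
  moreover from this have "(2 + of_nat k * 2 :: 'a) \<noteq> 0"
    by (metis distrib_right mult_1 mult_eq_0_iff zero_neq_numeral)
  ultimately show ?thesis
    by (simp add: wallis_def pochhammer_Suc divide_simps) (simp add: algebra_simps)
qed

lemma wallis_of_real: "(wallis k :: 'a::real_normed_field) = of_real (wallis k)"
  by (induction k) (simp_all add: wallis_Suc)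

lemma wallis_nonneg: "0 \<le> (wallis k :: real)"
  by (simp add: wallis_def pochhammer_nonneg)

lemma wallis_le_1: "(wallis k :: real) \<le> 1"
proof (induction k)
  case (Suc k)
  have "of_nat (2 * k + 1) / of_nat (2 * k + 2) \<le> (1 :: real)"
    by (simp add: divide_simps)
  with Suc wallis_nonneg[of k] show ?case
    unfolding wallis_Suc by (intro mult_le_one) auto
qed simp

lemma norm_wallis_le_1: "norm (wallis k :: 'a::real_normed_field) \<le> 1"
  using wallis_nonneg[of k] wallis_le_1[of k] by (subst wallis_of_real) simp

text \<open>
  Wallis' reduction: the derivative of \<open>cos \<theta> sin\<^bsup>2k+1\<^esup> \<theta>\<close> combines the powers \<open>2k\<close> and
  \<open>2k + 2\<close> of the sine, and this function vanishes at both ends of the interval.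
\<close>

lemma has_integral_sin_even_power:
  "((\<lambda>\<theta>. sin \<theta> ^ (2 * k)) has_integral (pi / 2 * wallis k)) {0..pi / 2 :: real}"
proof (induction k)
  case 0
  then show ?case
    using has_integral_const_real[of "1::real" 0 "pi/2"] by simp
next
  case (Suc k)
  define a b where "a = real (2 * k + 2)" and "b = real (2 * k + 1)"
  let ?d = "\<lambda>\<theta>. b * sin \<theta> ^ (2 * k) - a * sin \<theta> ^ (2 * Suc k)"
  have "((\<lambda>\<theta>. cos \<theta> * sin \<theta> ^ (2 * k + 1)) has_vector_derivative ?d \<theta>) (at \<theta> within A)"
    for \<theta> :: real and A
  proof -
    have "((\<lambda>\<theta>. cos \<theta> * sin \<theta> ^ (2 * k + 1)) has_real_derivative
        b * (cos \<theta>)\<^sup>2 * sin \<theta> ^ (2 * k) - sin \<theta> ^ (2 * Suc k)) (at \<theta> within A)"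
      by (rule derivative_eq_intros refl | simp add: b_def power2_eq_square algebra_simps)+
    also have "b * (cos \<theta>)\<^sup>2 * sin \<theta> ^ (2 * k) - sin \<theta> ^ (2 * Suc k) = ?d \<theta>"
      unfolding cos_squared_eq by (simp add: a_def b_def power2_eq_square algebra_simps)
    finally show ?thesis
      by (simp add: has_real_derivative_iff_has_vector_derivative)
  qed
  then have "(?d has_integral
      (cos (pi/2) * sin (pi/2) ^ (2 * k + 1) - cos 0 * sin 0 ^ (2 * k + 1))) {0..pi/2}"
    by (intro fundamental_theorem_of_calculus) auto
  then have "(?d has_integral 0) {0..pi/2}"
    by simp
  from has_integral_diff[OF has_integral_mult_right[OF Suc, of b] this]
  have "((\<lambda>\<theta>. a * sin \<theta> ^ (2 * Suc k)) has_integral (b * (pi / 2 * wallis k))) {0..pi / 2}"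
    by simp
  from has_integral_mult_right[OF this, of "1 / a"]
  have "((\<lambda>\<theta>. sin \<theta> ^ (2 * Suc k)) has_integral (1 / a * (b * (pi / 2 * wallis k)))) {0..pi / 2}"
    by (simp add: a_def)
  also have "1 / a * (b * (pi / 2 * wallis k)) = pi / 2 * wallis (Suc k)"
    unfolding wallis_Suc a_def b_def by simp
  finally show ?case .
qed

text \<open>
  The principal branch of the binomial series for the exponent \<open>-1/2\<close>; the signs of the
  generalised binomial coefficients cancel those of \<open>(-w) ^ k\<close>.
\<close>

lemma wallis_binomial_sums:
  fixes w :: complex
  assumes "norm w < 1"
  shows "(\<lambda>k. wallis k * w ^ k) sums (1 / csqrt (1 - w))"
proof -
  have "((-(1/2)) gchoose k) * (-w) ^ k = wallis k * w ^ k" for k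
  proof -
    have "((-(1/2)) gchoose k) * (-w) ^ k = ((-1) ^ k * (-1) ^ k) * wallis k * w ^ k"
      unfolding gbinomial_pochhammer wallis_def power_minus[of w] by simp
    also have "(-1) ^ k * (-1) ^ k = (1 :: complex)"
      by (simp flip: power_mult_distrib)
    finally show ?thesis by simp
  qed
  with gen_binomial_complex[of "-w" "-(1/2)"] assms show ?thesis
    by (simp add: csqrt_conv_powr powr_minus_divide)
qed

section \<open>The power series of the elliptic integral\<close>

text \<open>
  The binomial series of the integrand is dominated by the geometric series with ratio
  \<open>|z|\<^sup>2\<close>, uniformly in \<open>\<theta>\<close>, so that it may be integrated term by term. One factor
  \<open>wallis k\<close> comes from the series and the other from the integral.
\<close>

lemma elliptic_K_sums:
  fixes z :: complex
  assumes "norm z < 1"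
  shows "(\<lambda>k. complex_of_real (pi / 2) * (wallis k ^ 2 * (z\<^sup>2) ^ k)) sums elliptic_K z"
proof -
  let ?t = "\<lambda>k \<theta>. wallis k * (z\<^sup>2 * (complex_of_real (sin \<theta>))\<^sup>2) ^ k"
  let ?g = "\<lambda>\<theta>. 1 / csqrt (1 - z\<^sup>2 * (complex_of_real (sin \<theta>))\<^sup>2)"
  define r where "r = (norm z)\<^sup>2"
  have r: "0 \<le> r" "r < 1"
    using assms by (auto simp: r_def power_less_one_iff abs_square_less_1)
  have le_r: "norm (z\<^sup>2 * (complex_of_real (sin \<theta>))\<^sup>2) \<le> r" for \<theta>
    using mult_left_le[of "(sin \<theta>)\<^sup>2" r] r(1)
    by (simp add: norm_mult norm_power r_def abs_square_le_1)
  have bound: "norm (?t k \<theta>) \<le> r ^ k" for k \<theta>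
    unfolding norm_mult[of "wallis k"] norm_power[of "z\<^sup>2 * _"]
    using mult_mono[OF norm_wallis_le_1 power_mono[OF le_r norm_ge_zero]] by fastforce
  have "(\<Sum>k. ?t k \<theta>) = ?g \<theta>" for \<theta>
    using wallis_binomial_sums[OF le_less_trans[OF le_r r(2)]] by (rule sums_unique[symmetric])
  with Weierstrass_m_test[of "{0..pi/2}" ?t "\<lambda>k. r ^ k", OF bound] r
  have "uniform_limit {0..pi/2} (\<lambda>n \<theta>. \<Sum>k<n. ?t k \<theta>) ?g sequentially"
    by (simp add: summable_geometric)
  then obtain I J where IJ: "\<And>n. ((\<lambda>\<theta>. \<Sum>k<n. ?t k \<theta>) has_integral I n) {0..pi/2}"
     "(?g has_integral J) {0..pi/2}" "I \<longlonglongrightarrow> J"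
    by (rule uniform_limit_integral) (auto intro!: continuous_intros)
  have "(?t k has_integral (complex_of_real (pi / 2) * (wallis k ^ 2 * (z\<^sup>2) ^ k))) {0..pi/2}" for k
    using has_integral_mult_right[OF has_integral_of_real[OF has_integral_sin_even_power[of k]],
        of "wallis k * (z\<^sup>2) ^ k"] wallis_of_real[of k, where 'a = complex]
    by (simp add: power_mult_distrib power_mult power2_eq_square mult_ac)
  then have "((\<lambda>\<theta>. \<Sum>k<n. ?t k \<theta>) has_integral
      (\<Sum>k<n. complex_of_real (pi / 2) * (wallis k ^ 2 * (z\<^sup>2) ^ k))) {0..pi/2}" for n
    by (intro has_integral_sum) auto
  then have "I = (\<lambda>n. \<Sum>k<n. complex_of_real (pi / 2) * (wallis k ^ 2 * (z\<^sup>2) ^ k))"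
    using has_integral_unique[OF IJ(1)] by blast
  moreover have "J = elliptic_K z"
    using IJ(2) by (simp add: elliptic_K_def integral_unique)
  ultimately show ?thesis
    using IJ(3) unfolding sums_def by simp
qed

definition elliptic_fps :: "'a::field_char_0 fps" where
  "elliptic_fps = Abs_fps (\<lambda>k. wallis k ^ 2)"

lemma elliptic_fps_nth: "elliptic_fps $ k = wallis k ^ 2"
  by (simp add: elliptic_fps_def)

lemma eval_elliptic_fps: "eval_fps elliptic_fps w = hypergeo_F (1/2) (1/2) 1 w"
  by (simp add: eval_fps_def elliptic_fps_nth hypergeo_F_def wallis_def power2_eq_square
           flip: pochhammer_fact)

text \<open>The coefficients are bounded by 1, so the geometric series is a majorant.\<close>

lemma conv_radius_elliptic_fps: "fps_conv_radius (elliptic_fps :: complex fps) \<ge> 1"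
  unfolding fps_conv_radius_def
proof (rule conv_radius_geI_ex')
  fix r :: real assume r: "0 < r" "ereal r < 1"
  have "norm (elliptic_fps $ n * complex_of_real r ^ n) \<le> r ^ n" for n
    using mult_right_mono[of "norm (wallis n ^ 2 :: complex)" 1 "r ^ n"] r
      norm_wallis_le_1[of n, where 'a = complex]
    by (simp add: elliptic_fps_nth norm_mult norm_power power_le_one)
  then show "summable (\<lambda>n. elliptic_fps $ n * complex_of_real r ^ n)"
    using r by (intro summable_comparison_test'[OF summable_geometric[of r]]) auto
qed

theorem elliptic_K_eq_hypergeo_F:
  assumes "norm z < 1"
  shows "elliptic_K z = complex_of_real (pi / 2) * hypergeo_F (1/2) (1/2) 1 (z\<^sup>2)"
proof -
  have "norm (z\<^sup>2) < 1"
    using assms by (simp add: norm_power abs_square_less_1)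
  then have "ereal (norm (z\<^sup>2)) < fps_conv_radius (elliptic_fps :: complex fps)"
    using conv_radius_elliptic_fps by (metis ereal_less(3) less_le_trans)
  from sums_mult[OF sums_eval_fps[OF this], of "complex_of_real (pi / 2)"] elliptic_K_sums[OF assms]
  show ?thesis
    by (simp only: elliptic_fps_nth eval_elliptic_fps) (rule sums_unique2)
qed

section \<open>The differential equation of the cube\<close>

text \<open>
  In terms of coefficients \<open>a\<^sub>k\<close> this is \<open>(2m + 2)\<^sup>2 a\<^sub>m\<^sub>+\<^sub>1 = (2m + 1)\<^sup>2 a\<^sub>m\<close>, the square of the
  recurrence of the Wallis ratios. The operator \<open>fps_XD\<close> is \<open>\<theta> = x d/dx\<close>.
\<close>

lemma elliptic_fps_ode:
  fixes E :: "'a::field_char_0 fps"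
  defines "E \<equiv> elliptic_fps"
  shows "4 * (1 - fps_X) * fps_XD (fps_XD E) = fps_X * (4 * fps_XD E + E)"
proof (rule fps_ext)
  fix n
  show "(4 * (1 - fps_X) * fps_XD (fps_XD E)) $ n = (fps_X * (4 * fps_XD E + E)) $ n"
  proof (cases n)
    case (Suc m)
    have "(of_nat (2 * m + 2) :: 'a) \<noteq> 0"
      by (simp only: of_nat_eq_0_iff)
    then have "of_nat (2 * m + 2) * wallis (Suc m) = of_nat (2 * m + 1) * (wallis m :: 'a)"
      unfolding wallis_Suc by simp
    then have "(of_nat (2 * m + 2) * wallis (Suc m))\<^sup>2 = (of_nat (2 * m + 1) * (wallis m :: 'a))\<^sup>2"
      by simp
    then show ?thesis
      by (simp add: E_def elliptic_fps_nth Suc numeral_fps_const mult.assoc left_diff_distrib)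
         (simp add: power2_eq_square algebra_simps)
  qed (simp add: E_def elliptic_fps_nth numeral_fps_const mult.assoc left_diff_distrib)
qed

lemma fps_XD_mult: "fps_XD (f * g) = fps_XD f * g + f * fps_XD (g :: 'a::comm_ring_1 fps)"
  by (simp add: fps_XD_def algebra_simps)

lemma fps_XD_simps:
  fixes f g :: "'a::comm_ring_1 fps"
  shows "fps_XD (f + g) = fps_XD f + fps_XD g"
    and "fps_XD (f - g) = fps_XD f - fps_XD g"
    and "fps_XD (numeral m) = (0 :: 'a fps)"
    and "fps_XD 1 = (0 :: 'a fps)"
    and "fps_XD fps_X = (fps_X :: 'a fps)"
  by (simp_all add: fps_XD_def algebra_simps)

text \<open>
  The algebraic core of the symmetric cube. The letters \<open>F, G, H, J, K\<close> stand for
  \<open>\<theta>\<^sup>i F\<close>, \<open>i = 0, \<dots>, 4\<close>, and the hypotheses for the differential equation of \<open>F\<close> and its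
  first two derivatives under \<open>\<theta>\<close>; \<open>Y0, \<dots>, Y4\<close> are the resulting \<open>\<theta>\<^sup>i F\<^sup>3\<close>. The conclusion
  lies in the ideal generated by the hypotheses, without any division by \<open>1 - x\<close>. The reason is
  that the coefficients of \<open>Y4\<close>, \<open>Y3\<close>, \<open>Y2\<close> are divisible by \<open>(1 - x)\<^sup>3\<close>, \<open>(1 - x)\<^sup>2\<close>, \<open>1 - x\<close>,
  which is just what is needed to replace \<open>K\<close>, then \<open>J\<close>, then \<open>H\<close>.
\<close>

lemma symmetric_cube_elimination:
  fixes x F G H J K :: "'a::idom"
  assumes H: "4 * (1 - x) * H = x * (4 * G + F)"
    and J: "4 * (1 - x) * J = x * (8 * H + 5 * G + F)"
    and K: "4 * (1 - x) * K = x * (12 * J + 13 * H + 6 * G + F)"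
  defines "Y0 \<equiv> F^3" and "Y1 \<equiv> 3*F\<^sup>2*G" and "Y2 \<equiv> 6*F*G\<^sup>2 + 3*F\<^sup>2*H"
   and "Y3 \<equiv> 6*G^3 + 18*F*G*H + 3*F\<^sup>2*J"
   and "Y4 \<equiv> 36*G\<^sup>2*H + 18*F*H\<^sup>2 + 24*F*G*J + 3*F\<^sup>2*K"
  shows "16 * Y4 - 4 * x * (12 * Y4 + 24 * Y3 + 26 * Y2 + 14 * Y1 + 3 * Y0)
    + x\<^sup>2 * (48 * Y4 + 192 * Y3 + 320 * Y2 + 256 * Y1 + 81 * Y0)
    - x^3 * (16 * Y4 + 96 * Y3 + 216 * Y2 + 216 * Y1 + 81 * Y0) = 0" (is "?E = 0")
proof -
  \<comment> \<open>The cofactors arise by eliminating \<open>K\<close> first. This produces new terms in \<open>J\<close>, and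
      eliminating those produces new terms in \<open>H\<close>. The square of \<open>H\<close> in \<open>Y4\<close> is removed as
      \<open>a\<^sup>2 - b\<^sup>2 = (a + b) (a - b)\<close>.\<close>
  have "?E = 12 * (1 - x)\<^sup>2 * F\<^sup>2 * (4 * (1 - x) * K - x * (12 * J + 13 * H + 6 * G + F))
      + (96 * (1 - x)\<^sup>2 * F * G - 36 * (1 - x) * x * F\<^sup>2)
        * (4 * (1 - x) * J - x * (8 * H + 5 * G + F))
      + (144 * (1 - x)\<^sup>2 * G\<^sup>2 + 18 * (1 - x) * F * (4 * (1 - x) * H + x * (4 * G + F))
         + 39 * (1 - x) * x * F\<^sup>2 - 432 * (1 - x) * x * F * G - 6 * x * (13 - 27 * x) * F\<^sup>2
         + 2 * x * (96 * (1 - x) * F * G - 36 * x * F\<^sup>2))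
        * (4 * (1 - x) * H - x * (4 * G + F))"
    unfolding Y0_def Y1_def Y2_def Y3_def Y4_def by algebra
  then show ?thesis
    by (simp only: H J K diff_self mult_zero_right add_0_left)
qed

text \<open>
  The coefficient of \<open>x\<^sup>j\<close> is a polynomial in \<open>\<theta>\<close>. Replacing \<open>\<theta>\<close> by \<open>n + 1 - j\<close> in it gives, up
  to sign and the common denominator \<open>16 (n + 1)\<^sup>4\<close>, the factor of the \<open>(n + 1 - j)\<close>th
  coefficient of the cube in its recurrence.
\<close>

theorem elliptic_fps_cube_ode:
  fixes y :: "'a::field_char_0 fps"
  defines "y \<equiv> elliptic_fps ^ 3"
  defines "y1 \<equiv> fps_XD y"
  defines "y2 \<equiv> fps_XD y1"
  defines "y3 \<equiv> fps_XD y2"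
  defines "y4 \<equiv> fps_XD y3"
  shows "16 * y4 - 4 * fps_X * (12 * y4 + 24 * y3 + 26 * y2 + 14 * y1 + 3 * y)
    + fps_X\<^sup>2 * (48 * y4 + 192 * y3 + 320 * y2 + 256 * y1 + 81 * y)
    - fps_X ^ 3 * (16 * y4 + 96 * y3 + 216 * y2 + 216 * y1 + 81 * y) = 0"
proof -
  define F where "F = (elliptic_fps :: 'a fps)"
  define G where "G = fps_XD F"
  define H where "H = fps_XD G"
  define J where "J = fps_XD H"
  define K where "K = fps_XD J"
  let ?X = "fps_X :: 'a fps"
  note D = fps_XD_mult fps_XD_simps G_def[symmetric] H_def[symmetric] J_def[symmetric]
    K_def[symmetric]
  have H: "4 * (1 - ?X) * H = ?X * (4 * G + F)"
    unfolding H_def G_def F_def by (rule elliptic_fps_ode)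
  then have "fps_XD (4 * ((1 - ?X) * H)) = fps_XD (?X * (4 * G + F))"
    by (simp only: mult.assoc)
  then have J: "4 * (1 - ?X) * J = ?X * (8 * H + 5 * G + F)"
    unfolding D using H by (simp add: algebra_simps)
  then have "fps_XD (4 * ((1 - ?X) * J)) = fps_XD (?X * (8 * H + 5 * G + F))"
    by (simp only: mult.assoc)
  then have K: "4 * (1 - ?X) * K = ?X * (12 * J + 13 * H + 6 * G + F)"
    unfolding D using J by (simp add: algebra_simps)
  have y: "y = F ^ 3"
    by (simp add: y_def F_def)
  have y1: "y1 = 3 * F\<^sup>2 * G"
    unfolding y1_def y by (simp only: D power2_eq_square power3_eq_cube) algebra
  have y2: "y2 = 6 * F * G\<^sup>2 + 3 * F\<^sup>2 * H"
    unfolding y2_def y1 by (simp only: D power2_eq_square power3_eq_cube) algebra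
  have y3: "y3 = 6 * G ^ 3 + 18 * F * G * H + 3 * F\<^sup>2 * J"
    unfolding y3_def y2 by (simp only: D power2_eq_square power3_eq_cube) algebra
  have y4: "y4 = 36 * G\<^sup>2 * H + 18 * F * H\<^sup>2 + 24 * F * G * J + 3 * F\<^sup>2 * K"
    unfolding y4_def y3 by (simp only: D power2_eq_square power3_eq_cube) algebra
  show ?thesis
    unfolding y y1 y2 y3 y4 by (rule symmetric_cube_elimination[OF H J K])
qed

section \<open>The coefficients of the cube\<close>

text \<open>
  This is the coefficient of \<open>x\<^bsup>n+1\<^esup>\<close> in the differential equation of the cube, solved for the
  leading term. For \<open>n \<ge> 2\<close> all four shifts contribute.
\<close>

lemma elliptic_fps_cube_recurrence:
  fixes c :: "nat \<Rightarrow> 'a::field_char_0" and n :: nat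
  defines "c \<equiv> fps_nth (elliptic_fps ^ 3)"
  assumes "n \<ge> 2"
  shows "c (n + 1) =
      (2 * of_nat n * (of_nat n + 1) * (6 * of_nat n * (of_nat n + 1) + 7) + 3)
        / (4 * (of_nat n + 1) ^ 4) * c n
      - (48 * of_nat n ^ 4 + 32 * of_nat n ^ 2 + 1) / (16 * (of_nat n + 1) ^ 4) * c (n - 1)
      + (1 - 2 * of_nat n) ^ 4 / (16 * (of_nat n + 1) ^ 4) * c (n - 2)"
proof -
  obtain m where n: "n = Suc (Suc m)"
    using assms(2) by (metis add_2_eq_Suc le_Suc_ex)
  define N where "N = (of_nat n :: 'a)"
  have N1: "N + 1 \<noteq> 0"
    unfolding N_def by (metis Suc_eq_plus1 of_nat_Suc of_nat_neq_0 add.commute)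
  have "16 * (N + 1) ^ 4 * c (Suc (Suc (Suc m)))
      - 4 * (12 * N ^ 4 + 24 * N ^ 3 + 26 * N ^ 2 + 14 * N + 3) * c (Suc (Suc m))
      + (48 * (N - 1) ^ 4 + 192 * (N - 1) ^ 3 + 320 * (N - 1) ^ 2 + 256 * (N - 1) + 81) * c (Suc m)
      - (16 * (N - 2) ^ 4 + 96 * (N - 2) ^ 3 + 216 * (N - 2) ^ 2 + 216 * (N - 2) + 81) * c m = 0"
    using arg_cong[where f = "\<lambda>f. f $ Suc (Suc (Suc m))", OF elliptic_fps_cube_ode[where 'a = 'a]]
    by (simp add: N_def n numeral_fps_const mult.assoc fps_X_power_mult_nth
             flip: c_def)
       (simp add: algebra_simps eval_nat_numeral)
  then have "16 * (N + 1) ^ 4 * c (Suc (Suc (Suc m)))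
      = 4 * (2 * N * (N + 1) * (6 * N * (N + 1) + 7) + 3) * c (Suc (Suc m))
      - (48 * N ^ 4 + 32 * N ^ 2 + 1) * c (Suc m) + (1 - 2 * N) ^ 4 * c m"
    by algebra
  \<comment> \<open>Stated for arbitrary coefficients so that the division does not multiply them out.\<close>
  moreover have "c' = A / (4 * D) * x - B / (16 * D) * y + C / (16 * D) * w"
    if "16 * D * c' = 4 * A * x - B * y + C * w" "D \<noteq> 0" for c' A B C D x y w :: 'a
    using that by (simp add: divide_simps) (simp add: algebra_simps)
  ultimately show ?thesis
    unfolding N_def[symmetric] using N1 by (simp add: n)
qed

lemma fps_cube_nth:
  fixes f :: "'a::comm_ring_1 fps"
  shows "(f ^ 3) $ 0 = (f $ 0) ^ 3"
    and "(f ^ 3) $ 1 = 3 * (f $ 0)\<^sup>2 * f $ 1"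
    and "(f ^ 3) $ 2 = 3 * (f $ 0)\<^sup>2 * f $ 2 + 3 * f $ 0 * (f $ 1)\<^sup>2"
  by (simp_all add: power3_eq_cube fps_mult_nth numeral_2_eq_2, simp_all add: algebra_simps)

lemma elliptic_fps_cube_initial:
  fixes c :: "nat \<Rightarrow> 'a::field_char_0"
  defines "c \<equiv> fps_nth (elliptic_fps ^ 3)"
  shows "c 0 = 1" and "c 1 = 3 / 4" and "c 2 = 39 / 64"
proof -
  have w1: "wallis 1 = (1 / 2 :: 'a)"
    using wallis_Suc[of 0, where 'a = 'a] by simp
  have w2: "wallis 2 = (3 / 8 :: 'a)"
    using wallis_Suc[of 1, where 'a = 'a] unfolding w1 by (simp add: numeral_2_eq_2)
  show "c 0 = 1" "c 1 = 3 / 4" "c 2 = 39 / 64"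
    unfolding c_def fps_cube_nth elliptic_fps_nth w1 w2 by (simp_all add: power_divide)
qed

section \<open>The cube of the elliptic integral\<close>

theorem corollary3p1:
  fixes z :: complex and v :: "nat \<Rightarrow> real"
  assumes "norm z < 1"
    and "v 0 = 1" and "v 1 = 3 / 4" and "v 2 = 39 / 64"
    and "\<And>n. n \<ge> 2 \<Longrightarrow>
      v (n + 1) =
        (2 * real n * (real n + 1) * (6 * real n * (real n + 1) + 7) + 3)
          / (4 * (real n + 1) ^ 4) * v n
        - (48 * real n ^ 4 + 32 * real n ^ 2 + 1) / (16 * (real n + 1) ^ 4) * v (n - 1)
        + (1 - 2 * real n) ^ 4 / (16 * (real n + 1) ^ 4) * v (n - 2)"
  shows "elliptic_K z ^ 3 = complex_of_real (pi ^ 3 / 8) * hypergeo_F (1 / 2) (1 / 2) 1 (z\<^sup>2) ^ 3 \<and>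
    summable (\<lambda>n. complex_of_real (v n) * z ^ (2 * n)) \<and>
    complex_of_real (pi ^ 3 / 8) * hypergeo_F (1 / 2) (1 / 2) 1 (z\<^sup>2) ^ 3 =
      complex_of_real (pi ^ 3 / 8) * (\<Sum>n. complex_of_real (v n) * z ^ (2 * n))"
proof -
  let ?E = "elliptic_fps :: complex fps"
  have coeff: "complex_of_real (v n) = (?E ^ 3) $ n" for n
  proof (induction n rule: less_induct)
    case (less n)
    consider "n = 0" | "n = 1" | "n = 2" | "n \<ge> 3"
      by linarith
    then show ?case
    proof cases
      case 1
      show ?thesis
        unfolding 1 assms(2) elliptic_fps_cube_initial by simp
    next
      case 2
      show ?thesis
        unfolding 2 assms(3) elliptic_fps_cube_initial by simp
    next
      case 3
      show ?thesis
        unfolding 3 assms(4) elliptic_fps_cube_initial by simp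
    next
      case 4
      define k where "k = n - 1"
      have k: "k \<ge> 2" "n = k + 1"
        using 4 by (auto simp: k_def)
      have "complex_of_real (v k) = (?E ^ 3) $ k"
        "complex_of_real (v (k - 1)) = (?E ^ 3) $ (k - 1)"
        "complex_of_real (v (k - 2)) = (?E ^ 3) $ (k - 2)"
        using k by (auto intro!: less)
      then show ?thesis
        unfolding k(2) assms(5)[OF k(1)] elliptic_fps_cube_recurrence[OF k(1)]
        by simp
    qed
  qed
  have "norm (z\<^sup>2) < 1"
    using assms(1) by (simp add: norm_power abs_square_less_1)
  then have r: "ereal (norm (z\<^sup>2)) < fps_conv_radius ?E"
    using conv_radius_elliptic_fps by (metis ereal_less(3) less_le_trans)
  have "(\<lambda>n. (?E ^ 3) $ n * (z\<^sup>2) ^ n) sums eval_fps (?E ^ 3) (z\<^sup>2)"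
    by (rule sums_eval_fps[OF less_le_trans[OF r fps_conv_radius_power]])
  then have "(\<lambda>n. complex_of_real (v n) * z ^ (2 * n)) sums hypergeo_F (1 / 2) (1 / 2) 1 (z\<^sup>2) ^ 3"
    by (simp add: coeff eval_fps_power[OF r] eval_elliptic_fps power_mult)
  moreover have "elliptic_K z ^ 3 =
      complex_of_real (pi ^ 3 / 8) * hypergeo_F (1 / 2) (1 / 2) 1 (z\<^sup>2) ^ 3"
    by (simp add: elliptic_K_eq_hypergeo_F[OF assms(1)] power_mult_distrib power_divide)
  ultimately show ?thesis
    by (auto simp: sums_iff)
qed

end
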